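(* Let $A$ be a vector space and $\alpha:A\to A$ a linear map. There is a one-to-one correspondence between Maurer-Cartan elements in the bidifferential graded Lie algebra $(C^{\ast+1}_\alpha(A,A),[\cdot,\cdot]_\alpha,d_1=0,d_2=0)$ and compatible Hom-associative algebra structures on $A$ (with twisting map $\alpha$); under this correspondence a pair $(\mu_1,\mu_2)\in C^2_\alpha(A,A)\oplus C^2_\alpha(A,A)$ of multiplicative bilinear maps corresponds to the compatible Hom-associative structure $(A,\mu_1,\mu_2,\alpha)$.
   Context: $\mathbb K$ is a field of characteristic $0$; all vector spaces are finite-dimensional over $\mathbb K$. A Hom-associative algebra $(A,\mu,\alpha)$ is a vector space $A$ with a bilinear map $\mu:A\otimes A\to A$, $\mu(a,b)=a\cdot b$, and a linear map $\alpha:A\to A$ such that $\alpha(a\cdot b)=\alpha(a)\cdot\alpha(b)$ and $(a\cdot b)\cdot\alpha(c)=\alpha(a)\cdot(b\cdot c)$ for all $a,b,c\in A$. A compatible Hom-associative algebra $(A,\mu_1,\mu_2,\alpha)$ is one where $(A,\mu_1,\alpha)$ and $(A,\mu_2,\alpha)$ are Hom-associative algebras and, writing $\cdot_1,\cdot_2$ for $\mu_1,\mu_2$, $(a\cdot_1 b)\cdot_2\alpha(c)+(a\cdot_2 b)\cdot_1\alpha(c)=\alpha(a)\cdot_1(b\cdot_2 c)+\alpha(a)\cdot_2(b\cdot_1 c)$ for all $a,b,c\in A$. For $n\ge 1$, $C^n_\alpha(A,A)$ is the space of linear maps $f:A^{\otimes n}\to A$ with $\alpha(f(a_1,\dots,a_n))=f(\alpha(a_1),\dots,\alpha(a_n))$.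 The space $C^{\ast+1}_\alpha(A,A)=\bigoplus_{n\ge0}C^{n+1}_\alpha(A,A)$, with $C^{n+1}_\alpha(A,A)$ in degree $n$, is a graded Lie algebra under the Gerstenhaber bracket: for $f\in C^{m+1}_\alpha(A,A)$, $g\in C^{n+1}_\alpha(A,A)$, $[f,g]_\alpha=f\diamond g-(-1)^{mn}g\diamond f$, where $$(f\diamond g)(a_1,\dots,a_{m+n+1})=\sum_{i=1}^{m+1}(-1)^{(i-1)n}f(\alpha^n(a_1),\dots,\alpha^n(a_{i-1}),g(a_i,\dots,a_{i+n}),\alpha^n(a_{i+n+1}),\dots,\alpha^n(a_{m+n+1})).$$ A bidifferential graded Lie algebra $(L=\oplus L^i,[\,,],d_1,d_2)$ is a graded Lie algebra with two degree $+1$ differentials, each a derivation of the bracket, such that $d_1d_2+d_2d_1=0$. A Maurer-Cartan element in it is a pair $(\theta_1,\theta_2)\in L^1\oplus L^1$ with $d_1\theta_1+\frac12[\theta_1,\theta_1]=0$, $d_2\theta_2+\frac12[\theta_2,\theta_2]=0$ and $d_1\theta_2+d_2\theta_1+[\theta_1,\theta_2]=0$. *)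

theory Defs
  imports Complex_Main "HOL-Library.Function_Algebras"
begin

(* A graded vector space is a family L 0, L 1, ... of subspaces of one ambient vector space,
   standing for the external direct sum of the L i (all other degrees are zero).
   "bracket i j" is the bracket on L i x L j. *)
locale graded_Lie_algebra = vector_space scale
  for scale :: "'k::field_char_0 \<Rightarrow> 'v::ab_group_add \<Rightarrow> 'v" +
  fixes L :: "nat \<Rightarrow> 'v set"
    and bracket :: "nat \<Rightarrow> nat \<Rightarrow> 'v \<Rightarrow> 'v \<Rightarrow> 'v"
  assumes subspace_L: "subspace (L i)"
    and bracket_closed: "x \<in> L i \<Longrightarrow> y \<in> L j \<Longrightarrow> bracket i j x y \<in> L (i + j)"
    and bracket_add_left: "x \<in> L i \<Longrightarrow> x' \<in> L i \<Longrightarrow> y \<in> L j \<Longrightarrow>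
      bracket i j (x + x') y = bracket i j x y + bracket i j x' y"
    and bracket_scale_left: "x \<in> L i \<Longrightarrow> y \<in> L j \<Longrightarrow>
      bracket i j (scale c x) y = scale c (bracket i j x y)"
    and bracket_add_right: "x \<in> L i \<Longrightarrow> y \<in> L j \<Longrightarrow> y' \<in> L j \<Longrightarrow>
      bracket i j x (y + y') = bracket i j x y + bracket i j x y'"
    and bracket_scale_right: "x \<in> L i \<Longrightarrow> y \<in> L j \<Longrightarrow>
      bracket i j x (scale c y) = scale c (bracket i j x y)"
    and bracket_skew: "x \<in> L i \<Longrightarrow> y \<in> L j \<Longrightarrow>
      bracket i j x y = - scale ((-1) ^ (i * j)) (bracket j i y x)"
    and bracket_Jacobi: "x \<in> L i \<Longrightarrow> y \<in> L j \<Longrightarrow> z \<in> L k \<Longrightarrow>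
      bracket i (j + k) x (bracket j k y z) =
        bracket (i + j) k (bracket i j x y) z
        + scale ((-1) ^ (i * j)) (bracket j (i + k) y (bracket i k x z))"

locale differential_graded_Lie_algebra = graded_Lie_algebra scale L bracket
  for scale :: "'k::field_char_0 \<Rightarrow> 'v::ab_group_add \<Rightarrow> 'v"
    and L :: "nat \<Rightarrow> 'v set"
    and bracket :: "nat \<Rightarrow> nat \<Rightarrow> 'v \<Rightarrow> 'v \<Rightarrow> 'v" +
  fixes d :: "nat \<Rightarrow> 'v \<Rightarrow> 'v"
  assumes d_closed: "x \<in> L i \<Longrightarrow> d i x \<in> L (Suc i)"
    and d_add: "x \<in> L i \<Longrightarrow> y \<in> L i \<Longrightarrow> d i (x + y) = d i x + d i y"
    and d_scale: "x \<in> L i \<Longrightarrow> d i (scale c x) = scale c (d i x)"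
    and d_square: "x \<in> L i \<Longrightarrow> d (Suc i) (d i x) = 0"
    and d_derivation: "x \<in> L i \<Longrightarrow> y \<in> L j \<Longrightarrow>
      d (i + j) (bracket i j x y) =
        bracket (Suc i) j (d i x) y + scale ((-1) ^ i) (bracket i (Suc j) x (d j y))"

locale bidifferential_graded_Lie_algebra =
  d1: differential_graded_Lie_algebra scale L bracket d1 +
  d2: differential_graded_Lie_algebra scale L bracket d2
  for scale :: "'k::field_char_0 \<Rightarrow> 'v::ab_group_add \<Rightarrow> 'v"
    and L :: "nat \<Rightarrow> 'v set"
    and bracket :: "nat \<Rightarrow> nat \<Rightarrow> 'v \<Rightarrow> 'v \<Rightarrow> 'v"
    and d1 d2 :: "nat \<Rightarrow> 'v \<Rightarrow> 'v" +
  assumes d_anticommute: "x \<in> L i \<Longrightarrow> d1 (Suc i) (d2 i x) + d2 (Suc i) (d1 i x) = 0"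

definition Maurer_Cartan ::
  "('k::field_char_0 \<Rightarrow> 'v::ab_group_add \<Rightarrow> 'v) \<Rightarrow> (nat \<Rightarrow> 'v set) \<Rightarrow>
   (nat \<Rightarrow> nat \<Rightarrow> 'v \<Rightarrow> 'v \<Rightarrow> 'v) \<Rightarrow> (nat \<Rightarrow> 'v \<Rightarrow> 'v) \<Rightarrow> (nat \<Rightarrow> 'v \<Rightarrow> 'v) \<Rightarrow> ('v \<times> 'v) set"
  where "Maurer_Cartan scale L bracket d1 d2 =
    {(\<theta>1, \<theta>2). \<theta>1 \<in> L 1 \<and> \<theta>2 \<in> L 1 \<and>
      d1 1 \<theta>1 + scale (1 / 2) (bracket 1 1 \<theta>1 \<theta>1) = 0 \<and>
      d2 1 \<theta>2 + scale (1 / 2) (bracket 1 1 \<theta>2 \<theta>2) = 0 \<and>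
      d1 1 \<theta>2 + d2 1 \<theta>1 + bracket 1 1 \<theta>1 \<theta>2 = 0}"

definition bilinear_map ::
  "('k::field \<Rightarrow> 'a::ab_group_add \<Rightarrow> 'a) \<Rightarrow> ('a \<Rightarrow> 'a \<Rightarrow> 'a) \<Rightarrow> bool"
  where "bilinear_map scale \<mu> \<longleftrightarrow>
    (\<forall>a. Vector_Spaces.linear scale scale (\<lambda>b. \<mu> a b)) \<and>
    (\<forall>b. Vector_Spaces.linear scale scale (\<lambda>a. \<mu> a b))"

definition Hom_associative_algebra ::
  "('k::field \<Rightarrow> 'a::ab_group_add \<Rightarrow> 'a) \<Rightarrow> ('a \<Rightarrow> 'a \<Rightarrow> 'a) \<Rightarrow> ('a \<Rightarrow> 'a) \<Rightarrow> bool"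
  where "Hom_associative_algebra scale \<mu> \<alpha> \<longleftrightarrow>
    bilinear_map scale \<mu> \<and> Vector_Spaces.linear scale scale \<alpha> \<and>
    (\<forall>a b. \<alpha> (\<mu> a b) = \<mu> (\<alpha> a) (\<alpha> b)) \<and>
    (\<forall>a b c. \<mu> (\<mu> a b) (\<alpha> c) = \<mu> (\<alpha> a) (\<mu> b c))"

definition compatible_Hom_associative_algebra ::
  "('k::field \<Rightarrow> 'a::ab_group_add \<Rightarrow> 'a) \<Rightarrow> ('a \<Rightarrow> 'a \<Rightarrow> 'a) \<Rightarrow> ('a \<Rightarrow> 'a \<Rightarrow> 'a) \<Rightarrow> ('a \<Rightarrow> 'a) \<Rightarrow> bool"
  where "compatible_Hom_associative_algebra scale \<mu>1 \<mu>2 \<alpha> \<longleftrightarrow>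
    Hom_associative_algebra scale \<mu>1 \<alpha> \<and> Hom_associative_algebra scale \<mu>2 \<alpha> \<and>
    (\<forall>a b c. \<mu>2 (\<mu>1 a b) (\<alpha> c) + \<mu>1 (\<mu>2 a b) (\<alpha> c) =
             \<mu>1 (\<alpha> a) (\<mu>2 b c) + \<mu>2 (\<alpha> a) (\<mu>1 b c))"

(* A linear map on the n-th tensor power of A is given as an n-linear map on lists of length n;
   it is 0 on lists of any other length, so that equality of cochains is equality of functions
   and the vector space structure is the pointwise one. *)
definition cochains ::
  "('k::field \<Rightarrow> 'a::ab_group_add \<Rightarrow> 'a) \<Rightarrow> ('a \<Rightarrow> 'a) \<Rightarrow> nat \<Rightarrow> ('a list \<Rightarrow> 'a) set"
  where "cochains scale \<alpha> n =
    {f. (\<forall>xs. length xs \<noteq> n \<longrightarrow> f xs = 0) \<and>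
        (\<forall>xs i. length xs = n \<longrightarrow> i < n \<longrightarrow>
          Vector_Spaces.linear scale scale (\<lambda>x. f (xs[i := x]))) \<and>
        (\<forall>xs. length xs = n \<longrightarrow> \<alpha> (f xs) = f (map \<alpha> xs))}"

definition cochain_scale ::
  "('k \<Rightarrow> 'a \<Rightarrow> 'a) \<Rightarrow> 'k \<Rightarrow> ('a list \<Rightarrow> 'a) \<Rightarrow> ('a list \<Rightarrow> 'a)"
  where "cochain_scale scale c f = (\<lambda>xs. scale c (f xs))"

(* f has degree m (so m + 1 arguments) and g has degree n. *)
definition diamond ::
  "('k::field \<Rightarrow> 'a::ab_group_add \<Rightarrow> 'a) \<Rightarrow> ('a \<Rightarrow> 'a) \<Rightarrow> nat \<Rightarrow> nat \<Rightarrow>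
   ('a list \<Rightarrow> 'a) \<Rightarrow> ('a list \<Rightarrow> 'a) \<Rightarrow> ('a list \<Rightarrow> 'a)"
  where "diamond scale \<alpha> m n f g = (\<lambda>xs.
    if length xs = m + n + 1 then
      \<Sum>i = 1..m + 1. scale ((-1) ^ ((i - 1) * n))
        (f (map (\<alpha> ^^ n) (take (i - 1) xs) @
            [g (take (n + 1) (drop (i - 1) xs))] @
            map (\<alpha> ^^ n) (drop (i + n) xs)))
    else 0)"

definition Gerstenhaber_bracket ::
  "('k::field \<Rightarrow> 'a::ab_group_add \<Rightarrow> 'a) \<Rightarrow> ('a \<Rightarrow> 'a) \<Rightarrow> nat \<Rightarrow> nat \<Rightarrow>
   ('a list \<Rightarrow> 'a) \<Rightarrow> ('a list \<Rightarrow> 'a) \<Rightarrow> ('a list \<Rightarrow> 'a)"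
  where "Gerstenhaber_bracket scale \<alpha> m n f g =
    diamond scale \<alpha> m n f g
    - cochain_scale scale ((-1) ^ (m * n)) (diamond scale \<alpha> n m g f)"

end

theory Submission
  imports Defs
begin

text \<open>
  Write \<open>f \<circ>\<^sub>i g\<close> for the cochain that inserts \<open>g\<close> into slot \<open>i\<close> of \<open>f\<close> and twists all other
  arguments by the power of \<open>\<alpha>\<close> equal to the degree of \<open>g\<close>, so that \<open>f \<diamond> g\<close> is the signed sum of
  the \<open>f \<circ>\<^sub>i g\<close>. Since cochains commute with \<open>\<alpha>\<close>, the twists are only counted, and the untwisted
  operad axioms survive: inserting \<open>h\<close> into an input that comes from \<open>g\<close> is the insertion of a
  composite of \<open>g\<close> and \<open>h\<close> (\<open>partial_comp_sequential\<close>), and insertions into different slots of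
  \<open>f\<close> commute up to a shift of the slot (\<open>partial_comp_parallel\<close>).

  Expand \<open>(f \<diamond> g) \<diamond> h\<close> into double insertions. Those with \<open>h\<close> inside \<open>g\<close> form \<open>f \<diamond> (g \<diamond> h)\<close>.
  What remains is the sum over insertions of \<open>h\<close> to the left of \<open>g\<close>, plus the sum over those to the
  right; the parallel axiom exchanges these two sums when \<open>g\<close> and \<open>h\<close> are swapped, up to the Koszul
  sign. So the associator of \<open>\<diamond>\<close> is graded symmetric in its last two arguments (\<open>diamond_pre_Lie\<close>),
  and the graded commutator of such a product satisfies the graded Jacobi identity. Any graded Lie
  algebra is bidifferential with both differentials zero.

  A cochain of degree 1 is the same as a multiplicative bilinear map. On three arguments,
  \<open>[\<theta>, \<theta>']\<close> is the sum of both mixed Hom-associators, and it vanishes on lists of any other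
  length. For \<open>\<theta> = \<theta>'\<close> this is twice the Hom-associator, and 2 is invertible; with zero differentials
  the first two Maurer-Cartan equations are therefore Hom-associativity, and the mixed one is the
  compatibility condition.
\<close>

section \<open>Multilinear cochains\<close>

lemma linear_comp:
  assumes "Vector_Spaces.linear s s f" and "Vector_Spaces.linear s s g"
  shows "Vector_Spaces.linear s s (\<lambda>x. g (f x))"
  using assms by (simp add: Vector_Spaces.linear_iff)

lemma linear_funpow:
  assumes "Vector_Spaces.linear s s f"
  shows "Vector_Spaces.linear s s (f ^^ n)"
proof (induction n)
  case 0
  then show ?case using assms by (simp add: Vector_Spaces.linear_iff id_def)
next
  case (Suc n)
  then show ?case using linear_comp[OF Suc assms] by (simp add: comp_def)
qed

lemma cochain_linear:
  assumes "f \<in> cochains s \<alpha> N" and "length A + length C + 1 = N"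
  shows "Vector_Spaces.linear s s (\<lambda>x. f (A @ x # C))"
proof -
  have "Vector_Spaces.linear s s (\<lambda>x. f ((A @ undefined # C)[length A := x]))"
    using assms unfolding cochains_def by (simp del: list_update_append list_update_length)
  then show ?thesis by simp
qed

lemma cochain_funpow:
  assumes "f \<in> cochains s \<alpha> N" and "length xs = N"
  shows "(\<alpha> ^^ k) (f xs) = f (map (\<alpha> ^^ k) xs)"
proof (induction k)
  case (Suc k)
  have "\<alpha> (f (map (\<alpha> ^^ k) xs)) = f (map \<alpha> (map (\<alpha> ^^ k) xs))"
    using assms unfolding cochains_def by simp
  then show ?case using Suc by (simp add: comp_def)
qed simp

text \<open>Concatenated lists describe a slot by what surrounds it. This fits insertions, which split the
  argument list, better than updating a list at a position.\<close>

lemma cochainsI: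
  assumes "\<And>xs. length xs \<noteq> N \<Longrightarrow> f xs = 0"
    and lin: "\<And>A C. length A + length C + 1 = N \<Longrightarrow> Vector_Spaces.linear s s (\<lambda>x. f (A @ x # C))"
    and "\<And>xs. length xs = N \<Longrightarrow> \<alpha> (f xs) = f (map \<alpha> xs)"
  shows "f \<in> cochains s \<alpha> N"
proof -
  have "Vector_Spaces.linear s s (\<lambda>x. f (xs[i := x]))" if "length xs = N" "i < N" for xs i
    using lin[of "take i xs" "drop (Suc i) xs"] that by (simp add: upd_conv_take_nth_drop)
  then show ?thesis using assms unfolding cochains_def by auto
qed

lemma vector_space_cochain_scale:
  "vector_space s \<Longrightarrow> vector_space (cochain_scale s)"
  unfolding vector_space_def cochain_scale_def by (auto simp: fun_eq_iff)

lemma subspace_cochains: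
  assumes "vector_space s" and alpha: "Vector_Spaces.linear s s \<alpha>"
  shows "module.subspace (cochain_scale s) (cochains s \<alpha> N)"
proof -
  interpret V: vector_space s by fact
  interpret W: vector_space "cochain_scale s" by (rule vector_space_cochain_scale) fact
  interpret a: Vector_Spaces.linear s s \<alpha> by fact
  show ?thesis
    unfolding W.subspace_def cochains_def
    by (auto simp: Vector_Spaces.linear_iff a.add a.scale a.zero cochain_scale_def V.scale_right_distrib
        V.scale_left_commute V.vector_space_axioms add_ac)
qed


section \<open>Partial compositions\<close>

text \<open>The operadic composition \<open>f \<circ>\<^sub>i g\<close>, with slots counted from 0, for \<open>g\<close> of degree \<open>n\<close>. The degree of
  \<open>f\<close> does not enter the formula.\<close>

definition partial_comp ::
  "('a \<Rightarrow> 'a) \<Rightarrow> nat \<Rightarrow> nat \<Rightarrow> ('a list \<Rightarrow> 'a) \<Rightarrow> ('a list \<Rightarrow> 'a) \<Rightarrow> 'a list \<Rightarrow> 'a"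
  where "partial_comp \<alpha> n i f g xs =
    f (map (\<alpha> ^^ n) (take i xs) @ g (take (Suc n) (drop i xs)) # map (\<alpha> ^^ n) (drop (i + Suc n) xs))"

lemma partial_comp_append:
  assumes "length A = i" and "length B = Suc n"
  shows "partial_comp \<alpha> n i f g (A @ B @ C) = f (map (\<alpha> ^^ n) A @ g B # map (\<alpha> ^^ n) C)"
  using assms by (simp add: partial_comp_def)

lemma split_list3:
  assumes "a + b \<le> length xs"
  obtains A B C where "xs = A @ B @ C" "length A = a" "length B = b" "length C = length xs - a - b"
proof (rule that[of "take a xs" "take b (drop a xs)" "drop b (drop a xs)"])
  show "xs = take a xs @ take b (drop a xs) @ drop b (drop a xs)"
    by (simp only: append_take_drop_id)
qed (use assms in simp_all)

lemma split_list5: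
  assumes "a + b + c + d \<le> length xs"
  obtains A B C D E where "xs = A @ B @ C @ D @ E" "length A = a" "length B = b" "length C = c"
    "length D = d"
proof -
  have "a + b \<le> length xs" using assms by simp
  from split_list3[OF this] obtain A B R
    where xs: "xs = A @ B @ R" "length A = a" "length B = b" "length R = length xs - a - b" .
  have "c + d \<le> length R" using assms unfolding xs(4) by linarith
  from split_list3[OF this] obtain C D E where R: "R = C @ D @ E" "length C = c" "length D = d" .
  show ?thesis
    by (rule that[of A B C D E]) (simp_all only: xs(1-3) R)
qed

text \<open>The arguments of \<open>f\<close> outside \<open>g\<close> are twisted by \<open>\<alpha>\<^sup>p\<close> and then by \<open>\<alpha>\<^sup>n\<close> on the
  left-hand side, and at once by the power \<open>n + p\<close> of \<open>\<alpha>\<close> on the right-hand side, \<open>n + p\<close> being the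
  degree of the inner composite. The list splits into
  \<open>A @ B @ C @ D @ E\<close>, where \<open>h\<close> reads \<open>C\<close>, and \<open>g\<close> reads \<open>B\<close>, the value of \<open>h\<close>, and \<open>D\<close>.\<close>

lemma partial_comp_sequential:
  assumes "i \<le> m" "k \<le> n" and len: "length xs = m + n + p + 1"
  shows "partial_comp \<alpha> p (i + k) (partial_comp \<alpha> n i f g) h xs
    = partial_comp \<alpha> (n + p) i f (partial_comp \<alpha> p k g h) xs"
proof -
  have "i + k + Suc p + (n - k) \<le> length xs" using assms by simp
  from split_list5[OF this] obtain A B C D E
    where xs: "xs = A @ B @ C @ D @ E" "length A = i" "length B = k" "length C = Suc p" "length D = n - k" .
  have "partial_comp \<alpha> p (i + k) (partial_comp \<alpha> n i f g) h ((A @ B) @ C @ (D @ E))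
      = partial_comp \<alpha> n i f g (map (\<alpha> ^^ p) A
          @ (map (\<alpha> ^^ p) B @ h C # map (\<alpha> ^^ p) D) @ map (\<alpha> ^^ p) E)"
    by (subst partial_comp_append) (simp_all add: xs(2,3,4))
  also have "\<dots> = f (map (\<alpha> ^^ (n + p)) A
      @ g (map (\<alpha> ^^ p) B @ h C # map (\<alpha> ^^ p) D) # map (\<alpha> ^^ (n + p)) E)"
    by (subst partial_comp_append)
      (use \<open>k \<le> n\<close> in \<open>simp_all add: xs(2,3,4,5) funpow_add[symmetric]\<close>)
  also have "\<dots> = partial_comp \<alpha> (n + p) i f (partial_comp \<alpha> p k g h) (A @ (B @ C @ D) @ E)"
    by (subst partial_comp_append)
      (use \<open>k \<le> n\<close> in \<open>simp_all add: xs(2,3,4,5) partial_comp_append\<close>)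
  finally show ?thesis by (simp add: xs(1))
qed

text \<open>Here \<open>h\<close> reads \<open>B\<close> and \<open>g\<close> reads \<open>D\<close> in \<open>A @ B @ C @ D @ E\<close>. The first inserted value gets twisted
  by the second insertion; as cochains commute with \<open>\<alpha>\<close>, that twist moves onto its arguments, and both
  orders give \<open>f\<close> with \<open>h (\<alpha>\<^sup>n B)\<close> and \<open>g (\<alpha>\<^sup>p D)\<close> inserted. The block for \<open>h\<close> has length \<open>p + 1\<close>
  and occupies one slot of \<open>f\<close>, whence the shift by \<open>p\<close>.\<close>

lemma partial_comp_parallel:
  assumes g: "g \<in> cochains s \<alpha> (Suc n)" and h: "h \<in> cochains s \<alpha> (Suc p)"
    and "j < i" "i \<le> m" and len: "length xs = m + n + p + 1"
  shows "partial_comp \<alpha> p j (partial_comp \<alpha> n i f g) h xs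
    = partial_comp \<alpha> n (i + p) (partial_comp \<alpha> p j f h) g xs"
proof -
  have "j + Suc p + (i - Suc j) + Suc n \<le> length xs" using assms by simp
  from split_list5[OF this] obtain A B C D E
    where xs: "xs = A @ B @ C @ D @ E" "length A = j" "length B = Suc p" "length C = i - Suc j"
      "length D = Suc n" .
  have "partial_comp \<alpha> p j (partial_comp \<alpha> n i f g) h (A @ B @ (C @ D @ E))
      = partial_comp \<alpha> n i f g ((map (\<alpha> ^^ p) A @ h B # map (\<alpha> ^^ p) C)
          @ map (\<alpha> ^^ p) D @ map (\<alpha> ^^ p) E)"
    by (subst partial_comp_append) (simp_all add: xs(2,3,4))
  also have "\<dots> = f (map (\<alpha> ^^ (n + p)) A @ h (map (\<alpha> ^^ n) B) # map (\<alpha> ^^ (n + p)) C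
      @ g (map (\<alpha> ^^ p) D) # map (\<alpha> ^^ (n + p)) E)"
    by (subst partial_comp_append)
      (use \<open>j < i\<close> in \<open>simp_all add: xs(2,3,4,5) funpow_add[symmetric] add.commute[of p n] cochain_funpow[OF h]\<close>)
  also have "\<dots> = partial_comp \<alpha> p j f h (map (\<alpha> ^^ n) A @ map (\<alpha> ^^ n) B
      @ (map (\<alpha> ^^ n) C @ g D # map (\<alpha> ^^ n) E))"
    by (subst partial_comp_append)
      (use \<open>j < i\<close> in \<open>simp_all add: xs(2,3,4,5) funpow_add[symmetric] add.commute[of p n] cochain_funpow[OF g]\<close>)
  also have "\<dots> = partial_comp \<alpha> n (i + p) (partial_comp \<alpha> p j f h) g ((A @ B @ C) @ D @ E)"
    by (subst partial_comp_append) (use \<open>j < i\<close> in \<open>simp_all add: xs(2,3,4,5)\<close>)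
  finally show ?thesis by (simp add: xs(1))
qed

text \<open>The distinguished argument is, in turn, to the left of the block read by \<open>g\<close>, inside it, or to the
  right of it: a twisted argument of \<open>f\<close> in the outer cases, an argument of \<open>g\<close> in the middle one.\<close>

lemma partial_comp_linear:
  assumes alpha: "Vector_Spaces.linear s s \<alpha>"
    and f: "f \<in> cochains s \<alpha> (Suc m)" and g: "g \<in> cochains s \<alpha> (Suc n)" and "i \<le> m"
    and len: "length A + length C = m + n"
  shows "Vector_Spaces.linear s s (\<lambda>x. partial_comp \<alpha> n i f g (A @ x # C))"
proof -
  note alpha_n = linear_funpow[OF alpha, of n]
  consider "length A < i" | "i \<le> length A" "length A \<le> i + n" | "i + n < length A" by linarith
  then show ?thesis
  proof cases
    case 1
    then have "i - Suc (length A) + Suc n \<le> length C" using assms by simp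
    from split_list3[OF this] obtain C1 C2 C3 where C: "C = C1 @ C2 @ C3"
      "length C1 = i - Suc (length A)" "length C2 = Suc n"
      "length C3 = length C - (i - Suc (length A)) - Suc n" .
    have eq: "partial_comp \<alpha> n i f g (A @ x # C)
        = f (map (\<alpha> ^^ n) A @ (\<alpha> ^^ n) x # map (\<alpha> ^^ n) C1 @ g C2 # map (\<alpha> ^^ n) C3)" for x
      using partial_comp_append[of "A @ x # C1" i C2 n \<alpha> f g C3] C(2,3) 1 by (simp add: C(1))
    have lin: "Vector_Spaces.linear s s
        (\<lambda>x. f (map (\<alpha> ^^ n) A @ x # (map (\<alpha> ^^ n) C1 @ g C2 # map (\<alpha> ^^ n) C3)))"
      by (rule cochain_linear[OF f]) (use C(2-4) 1 len \<open>i \<le> m\<close> in simp)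
    show ?thesis unfolding eq using linear_comp[OF alpha_n lin] by (simp only: append_Cons append_assoc)
  next
    case 2
    define A1 A2 C1 C2 where "A1 = take i A" and "A2 = drop i A"
      and "C1 = take (n + i - length A) C" and "C2 = drop (n + i - length A) C"
    then have A: "A = A1 @ A2" "length A1 = i" "length A = i + length A2"
      and C: "C = C1 @ C2" "length A2 + length C1 = n" "length C = length C1 + length C2"
      using 2 len \<open>i \<le> m\<close> by simp_all
    have eq: "partial_comp \<alpha> n i f g (A @ x # C)
        = f (map (\<alpha> ^^ n) A1 @ g (A2 @ x # C1) # map (\<alpha> ^^ n) C2)" for x
      using partial_comp_append[of A1 i "A2 @ x # C1" n \<alpha> f g C2] A(2) C(2) unfolding A(1) C(1) by simp
    have lin_g: "Vector_Spaces.linear s s (\<lambda>x. g (A2 @ x # C1))"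
      by (rule cochain_linear[OF g]) (use C(2) in simp)
    have lin: "Vector_Spaces.linear s s (\<lambda>y. f (map (\<alpha> ^^ n) A1 @ y # map (\<alpha> ^^ n) C2))"
      by (rule cochain_linear[OF f]) (use A(2,3) C(2,3) len \<open>i \<le> m\<close> in simp)
    show ?thesis unfolding eq by (rule linear_comp[OF lin_g lin])
  next
    case 3
    then have "i + Suc n \<le> length A" by simp
    from split_list3[OF this] obtain A1 A2 A3
      where A: "A = A1 @ A2 @ A3" "length A1 = i" "length A2 = Suc n" "length A3 = length A - i - Suc n" .
    have eq: "partial_comp \<alpha> n i f g (A @ x # C)
        = f ((map (\<alpha> ^^ n) A1 @ g A2 # map (\<alpha> ^^ n) A3) @ (\<alpha> ^^ n) x # map (\<alpha> ^^ n) C)" for x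
      using partial_comp_append[of A1 i A2 n \<alpha> f g "A3 @ x # C"] A(2,3) by (simp add: A(1))
    have lin: "Vector_Spaces.linear s s
        (\<lambda>x. f ((map (\<alpha> ^^ n) A1 @ g A2 # map (\<alpha> ^^ n) A3) @ x # map (\<alpha> ^^ n) C))"
      by (rule cochain_linear[OF f]) (use A(2-4) 3 len \<open>i \<le> m\<close> in simp)
    show ?thesis unfolding eq using linear_comp[OF alpha_n lin] by (simp only: append_Cons append_assoc)
  qed
qed

lemma partial_comp_equivariant:
  assumes f: "f \<in> cochains s \<alpha> (Suc m)" and g: "g \<in> cochains s \<alpha> (Suc n)" and "i \<le> m"
    and len: "length xs = m + n + 1"
  shows "\<alpha> (partial_comp \<alpha> n i f g xs) = partial_comp \<alpha> n i f g (map \<alpha> xs)"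
proof -
  have "i + Suc n \<le> length xs" using assms by simp
  from split_list3[OF this] obtain A B C
    where xs: "xs = A @ B @ C" "length A = i" "length B = Suc n" "length C = length xs - i - Suc n" .
  have "\<alpha> (f ys) = f (map \<alpha> ys)" if "length ys = Suc m" for ys
    using f that unfolding cochains_def by simp
  moreover have "\<alpha> (g ys) = g (map \<alpha> ys)" if "length ys = Suc n" for ys
    using g that unfolding cochains_def by simp
  ultimately show ?thesis
    using xs len \<open>i \<le> m\<close> by (simp add: partial_comp_append comp_def funpow_swap1)
qed


section \<open>The pre-Lie product\<close>

lemma diamond_apply:
  assumes "length xs = m + n + 1"
  shows "diamond s \<alpha> m n f g xs = (\<Sum>i\<le>m. s ((-1) ^ (i * n)) (partial_comp \<alpha> n i f g xs))"
proof -
  have "diamond s \<alpha> m n f g xs = (\<Sum>i = Suc 0..Suc m. s ((-1) ^ ((i - 1) * n))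
        (f (map (\<alpha> ^^ n) (take (i - 1) xs) @
            [g (take (n + 1) (drop (i - 1) xs))] @
            map (\<alpha> ^^ n) (drop (i + n) xs))))"
    using assms by (simp add: diamond_def)
  also have "\<dots> = (\<Sum>i = 0..m. s ((-1) ^ (i * n)) (partial_comp \<alpha> n i f g xs))"
    by (subst sum.shift_bounds_cl_Suc_ivl) (simp add: partial_comp_def)
  finally show ?thesis by (simp add: atMost_atLeast0)
qed

lemma diamond_other_length: "length xs \<noteq> m + n + 1 \<Longrightarrow> diamond s \<alpha> m n f g xs = 0"
  by (simp add: diamond_def)

locale hom_vector_space = vector_space scale
  for scale :: "'k::field_char_0 \<Rightarrow> 'a::ab_group_add \<Rightarrow> 'a" +
  fixes \<alpha> :: "'a \<Rightarrow> 'a"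
  assumes linear_alpha: "Vector_Spaces.linear scale scale \<alpha>"
begin

abbreviation C :: "nat \<Rightarrow> ('a list \<Rightarrow> 'a) set"
  where "C n \<equiv> cochains scale \<alpha> (Suc n)"

sublocale cochain: vector_space "cochain_scale scale"
  by (rule vector_space_cochain_scale) (rule vector_space_axioms)

lemma subspace_C: "cochain.subspace (C n)"
  by (rule subspace_cochains) (rule vector_space_axioms linear_alpha)+

lemma sign_scale: "scale ((-1) ^ k) x = (if even k then x else - x)"
  by simp

lemma cochain_sign_scale: "cochain_scale scale ((-1) ^ k) f = (if even k then f else - f)"
  by simp

lemma diamond_closed:
  assumes f: "f \<in> C m" and g: "g \<in> C n"
  shows "diamond scale \<alpha> m n f g \<in> C (m + n)"
proof (rule cochainsI)
  fix xs :: "'a list"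
  assume "length xs \<noteq> Suc (m + n)"
  then show "diamond scale \<alpha> m n f g xs = 0" by (simp add: diamond_def)
next
  fix A B :: "'a list"
  assume len: "length A + length B + 1 = Suc (m + n)"
  have eq: "diamond scale \<alpha> m n f g (A @ x # B)
      = (\<Sum>i\<le>m. scale ((-1) ^ (i * n)) (partial_comp \<alpha> n i f g (A @ x # B)))" for x
    by (rule diamond_apply) (use len in simp)
  have lin: "Vector_Spaces.linear scale scale (\<lambda>x. partial_comp \<alpha> n i f g (A @ x # B))"
    if "i \<le> m" for i
    by (rule partial_comp_linear[OF linear_alpha f g that]) (use len in simp)
  show "Vector_Spaces.linear scale scale (\<lambda>x. diamond scale \<alpha> m n f g (A @ x # B))"
    unfolding eq using lin
    by (auto simp: Vector_Spaces.linear_iff scale_right_distrib scale_sum_right mult.commute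
        simp flip: sum.distrib intro!: sum.cong)
next
  fix xs :: "'a list"
  assume len: "length xs = Suc (m + n)"
  interpret a: Vector_Spaces.linear scale scale \<alpha> by (rule linear_alpha)
  show "\<alpha> (diamond scale \<alpha> m n f g xs) = diamond scale \<alpha> m n f g (map \<alpha> xs)"
    using len by (simp add: diamond_apply a.sum a.scale partial_comp_equivariant[OF f g])
qed

lemma diamond_add_left:
  "diamond scale \<alpha> m n (f + f') g = diamond scale \<alpha> m n f g + diamond scale \<alpha> m n f' g"
  by (auto simp: diamond_def fun_eq_iff scale_right_distrib sum.distrib)

lemma diamond_scale_left:
  "diamond scale \<alpha> m n (cochain_scale scale c f) g = cochain_scale scale c (diamond scale \<alpha> m n f g)"
  by (auto simp: diamond_def fun_eq_iff cochain_scale_def scale_sum_right mult.commute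
      simp del: sum.cl_ivl_Suc intro!: sum.cong)

lemma partial_comp_right_linear:
  assumes "f \<in> C m" and "i \<le> m" and "length xs = m + n + 1"
  shows "Vector_Spaces.linear scale scale
    (\<lambda>x. f (map (\<alpha> ^^ n) (take i xs) @ x # map (\<alpha> ^^ n) (drop (i + Suc n) xs)))"
  by (rule cochain_linear[OF assms(1)]) (use assms in simp)

lemma diamond_add_right:
  assumes f: "f \<in> C m"
  shows "diamond scale \<alpha> m n f (g + g') = diamond scale \<alpha> m n f g + diamond scale \<alpha> m n f g'"
proof
  fix xs
  show "diamond scale \<alpha> m n f (g + g') xs = (diamond scale \<alpha> m n f g + diamond scale \<alpha> m n f g') xs"
  proof (cases "length xs = m + n + 1")
    case True
    then show ?thesis
      using partial_comp_right_linear[OF f _ True]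
      by (auto simp: diamond_apply partial_comp_def Vector_Spaces.linear_iff scale_right_distrib
          simp flip: sum.distrib intro!: sum.cong)
  qed (simp add: diamond_other_length)
qed

lemma diamond_scale_right:
  assumes f: "f \<in> C m"
  shows "diamond scale \<alpha> m n f (cochain_scale scale c g) = cochain_scale scale c (diamond scale \<alpha> m n f g)"
proof
  fix xs
  show "diamond scale \<alpha> m n f (cochain_scale scale c g) xs = cochain_scale scale c (diamond scale \<alpha> m n f g) xs"
  proof (cases "length xs = m + n + 1")
    case True
    then show ?thesis
      using partial_comp_right_linear[OF f _ True]
      by (auto simp: diamond_apply partial_comp_def Vector_Spaces.linear_iff cochain_scale_def scale_sum_right
          mult.commute intro!: sum.cong)
  qed (simp add: diamond_other_length cochain_scale_def)
qed

text \<open>The part of \<open>(f \<diamond> g) \<diamond> h\<close> in which \<open>h\<close> is inserted to the left of \<open>g\<close>. The part with \<open>h\<close> to the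
  right of \<open>g\<close> is, up to sign, the same expression with \<open>g\<close> and \<open>h\<close> exchanged.\<close>

definition disjoint_insertions ::
  "nat \<Rightarrow> nat \<Rightarrow> nat \<Rightarrow> ('a list \<Rightarrow> 'a) \<Rightarrow> ('a list \<Rightarrow> 'a) \<Rightarrow> ('a list \<Rightarrow> 'a) \<Rightarrow> 'a list \<Rightarrow> 'a"
  where "disjoint_insertions m n p f g h xs =
    (\<Sum>i\<le>m. \<Sum>j<i. scale ((-1) ^ (i * n + j * p)) (partial_comp \<alpha> p j (partial_comp \<alpha> n i f g) h xs))"

text \<open>Split the positions \<open>j \<le> m + n\<close> of \<open>h\<close> in \<open>f \<circ>\<^sub>i g\<close> at the block \<open>i, \<dots>, i + n\<close> occupied by \<open>g\<close>. The
  block contributes \<open>f \<diamond> (g \<diamond> h)\<close>. To its right, \<open>j = l + n\<close> for a slot \<open>l > i\<close> of \<open>f\<close>; the shift by \<open>n\<close>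
  produces the sign \<open>(-1)\<close> to the power \<open>n * p\<close>.\<close>

lemma diamond_associator:
  assumes f: "f \<in> C m" and g: "g \<in> C n" and h: "h \<in> C p" and len: "length xs = m + n + p + 1"
  shows "diamond scale \<alpha> (m + n) p (diamond scale \<alpha> m n f g) h xs
      - diamond scale \<alpha> m (n + p) f (diamond scale \<alpha> n p g h) xs
    = disjoint_insertions m n p f g h xs
      + scale ((-1) ^ (n * p)) (disjoint_insertions m p n f h g xs)"
proof -
  define F where "F i j = scale ((-1) ^ (i * n + j * p))
    (partial_comp \<alpha> p j (partial_comp \<alpha> n i f g) h xs)" for i j
  have left: "diamond scale \<alpha> (m + n) p (diamond scale \<alpha> m n f g) h xs
      = (\<Sum>i\<le>m. \<Sum>j\<le>m + n. F i j)"
  proof -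
    have "partial_comp \<alpha> p j (diamond scale \<alpha> m n f g) h xs
        = (\<Sum>i\<le>m. scale ((-1) ^ (i * n)) (partial_comp \<alpha> p j (partial_comp \<alpha> n i f g) h xs))"
      if "j \<le> m + n" for j
      unfolding partial_comp_def[of \<alpha> p j] by (rule diamond_apply) (use that len in simp)
    then have "diamond scale \<alpha> (m + n) p (diamond scale \<alpha> m n f g) h xs
        = (\<Sum>j\<le>m + n. \<Sum>i\<le>m. F i j)"
      using len
      by (auto simp: diamond_apply F_def scale_sum_right power_add mult.commute simp del: mult_minus1
          intro!: sum.cong)
    then show ?thesis by (simp add: sum.swap[of _ "{..m}"])
  qed
  have nested: "diamond scale \<alpha> m (n + p) f (diamond scale \<alpha> n p g h) xs
      = (\<Sum>i\<le>m. \<Sum>k\<le>n. F i (i + k))"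
  proof -
    have "scale ((-1) ^ (i * (n + p))) (partial_comp \<alpha> (n + p) i f (diamond scale \<alpha> n p g h) xs)
        = (\<Sum>k\<le>n. F i (i + k))" if i: "i \<le> m" for i
    proof -
      let ?f = "\<lambda>x. f (map (\<alpha> ^^ (n + p)) (take i xs) @ x # map (\<alpha> ^^ (n + p)) (drop (i + Suc (n + p)) xs))"
      interpret l: Vector_Spaces.linear scale scale ?f
        by (rule partial_comp_right_linear[OF f i]) (use len in simp)
      let ?ys = "take (Suc (n + p)) (drop i xs)"
      have "partial_comp \<alpha> (n + p) i f (diamond scale \<alpha> n p g h) xs
          = ?f (\<Sum>k\<le>n. scale ((-1) ^ (k * p)) (partial_comp \<alpha> p k g h ?ys))"
        unfolding partial_comp_def[of \<alpha> "n + p"] using len i by (subst diamond_apply) auto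
      also have "\<dots> = (\<Sum>k\<le>n. scale ((-1) ^ (k * p))
          (partial_comp \<alpha> (n + p) i f (partial_comp \<alpha> p k g h) xs))"
        unfolding l.sum l.scale partial_comp_def[of \<alpha> "n + p"] ..
      also have "\<dots> = (\<Sum>k\<le>n. scale ((-1) ^ (k * p))
          (partial_comp \<alpha> p (i + k) (partial_comp \<alpha> n i f g) h xs))"
        using partial_comp_sequential[OF i _ len] by (intro sum.cong) auto
      finally show ?thesis
        by (simp only: F_def scale_sum_right scale_scale power_add[symmetric]) (simp add: algebra_simps)
    qed
    then show ?thesis using len by (simp only: diamond_apply[of xs m "n + p"]) (auto simp: diamond_apply intro!: sum.cong)
  qed
  have split: "(\<Sum>j\<le>m + n. F i j)
      = (\<Sum>j<i. F i j) + (\<Sum>k\<le>n. F i (i + k)) + (\<Sum>l\<in>{i<..m}. F i (l + n))" if "i \<le> m" for i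
  proof -
    have "{..m + n} = {..<i} \<union> ({i..i + n} \<union> {i + n<..m + n})" using that by auto
    then have "(\<Sum>j\<le>m + n. F i j)
        = (\<Sum>j<i. F i j) + ((\<Sum>j\<in>{i..i + n}. F i j) + (\<Sum>j\<in>{i + n<..m + n}. F i j))"
      by (simp only:) (subst sum.union_disjoint; fastforce intro: sum.union_disjoint)
    moreover have "(\<Sum>j\<in>{i..i + n}. F i j) = (\<Sum>k\<le>n. F i (i + k))"
      by (rule sum.reindex_bij_witness[of _ "\<lambda>k. i + k" "\<lambda>j. j - i"]) auto
    moreover have "(\<Sum>j\<in>{i + n<..m + n}. F i j) = (\<Sum>l\<in>{i<..m}. F i (l + n))"
      by (rule sum.reindex_bij_witness[of _ "\<lambda>l. l + n" "\<lambda>j. j - n"]) auto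
    ultimately show ?thesis by (simp add: add.assoc)
  qed
  \<comment> \<open>With the slot \<open>l\<close> of \<open>h\<close> as outer index, these are the terms in which \<open>h\<close> is inserted first.\<close>
  have right: "(\<Sum>i\<le>m. \<Sum>l\<in>{i<..m}. F i (l + n))
      = scale ((-1) ^ (n * p)) (disjoint_insertions m p n f h g xs)"
  proof -
    have "(\<Sum>i\<le>m. \<Sum>l\<in>{i<..m}. F i (l + n)) = (\<Sum>i\<le>m. \<Sum>l\<in>{l. l \<in> {..m} \<and> i < l}. F i (l + n))"
      by (intro sum.cong) auto
    also have "\<dots> = (\<Sum>l\<le>m. \<Sum>i\<in>{i. i \<in> {..m} \<and> i < l}. F i (l + n))"
      by (rule sum.swap_restrict) auto
    also have "\<dots> = (\<Sum>l\<le>m. \<Sum>i<l. F i (l + n))"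
      by (intro sum.cong) auto
    also have "\<dots> = (\<Sum>l\<le>m. \<Sum>i<l. scale ((-1) ^ (n * p)) (scale ((-1) ^ (l * p + i * n))
        (partial_comp \<alpha> n i (partial_comp \<alpha> p l f h) g xs)))"
    proof (intro sum.cong refl)
      fix l i
      assume "l \<in> {..m}" "i \<in> {..<l}"
      then have "partial_comp \<alpha> n i (partial_comp \<alpha> p l f h) g xs
          = partial_comp \<alpha> p (l + n) (partial_comp \<alpha> n i f g) h xs"
        using len by (intro partial_comp_parallel[OF h g]) auto
      then show "F i (l + n) = scale ((-1) ^ (n * p)) (scale ((-1) ^ (l * p + i * n))
          (partial_comp \<alpha> n i (partial_comp \<alpha> p l f h) g xs))"
        by (simp only: F_def scale_scale power_add[symmetric]) (simp add: algebra_simps)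
    qed
    finally show ?thesis by (simp only: disjoint_insertions_def scale_sum_right)
  qed
  have before: "(\<Sum>i\<le>m. \<Sum>j<i. F i j) = disjoint_insertions m n p f g h xs"
    by (simp only: disjoint_insertions_def F_def)
  have "(\<Sum>i\<le>m. \<Sum>j\<le>m + n. F i j) = (\<Sum>i\<le>m. \<Sum>j<i. F i j)
      + (\<Sum>i\<le>m. \<Sum>k\<le>n. F i (i + k)) + (\<Sum>i\<le>m. \<Sum>l\<in>{i<..m}. F i (l + n))"
    by (simp add: split sum.distrib)
  then show ?thesis
    unfolding left nested right before by (simp add: algebra_simps)
qed

text \<open>The right-hand side of \<open>diamond_associator\<close> is symmetric under exchanging \<open>g\<close> and \<open>h\<close>, up to the
  sign \<open>(-1)\<close> to the power \<open>n * p\<close>.\<close>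

lemma diamond_pre_Lie:
  assumes f: "f \<in> C m" and g: "g \<in> C n" and h: "h \<in> C p"
  shows "diamond scale \<alpha> (m + n) p (diamond scale \<alpha> m n f g) h
      - diamond scale \<alpha> m (n + p) f (diamond scale \<alpha> n p g h)
    = cochain_scale scale ((-1) ^ (n * p))
      (diamond scale \<alpha> (m + p) n (diamond scale \<alpha> m p f h) g
        - diamond scale \<alpha> m (n + p) f (diamond scale \<alpha> p n h g))" (is "?l = ?r")
proof
  fix xs
  show "?l xs = ?r xs"
  proof (cases "length xs = m + n + p + 1")
    case True
    have "length xs = m + p + n + 1" using True by simp
    note this[THEN diamond_associator[OF f h g], unfolded add.commute[of p n] mult.commute[of p n]]
    then show ?thesis
      using diamond_associator[OF f g h True]
      by (simp add: cochain_scale_def sign_scale del: scale_minus_left)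
  qed (auto simp: diamond_def cochain_scale_def)
qed

section \<open>The graded Lie algebra\<close>

abbreviation bracket where "bracket \<equiv> Gerstenhaber_bracket scale \<alpha>"

lemma diamond_minus_left:
  "diamond scale \<alpha> m n (- f) g = - diamond scale \<alpha> m n f g"
  using diamond_scale_left[of m n "-1"] by simp

lemma diamond_minus_right:
  "f \<in> C m \<Longrightarrow> diamond scale \<alpha> m n f (- g) = - diamond scale \<alpha> m n f g"
  using diamond_scale_right[of f m n "-1"] by simp

lemma diamond_diff_left:
  "diamond scale \<alpha> m n (f - f') g = diamond scale \<alpha> m n f g - diamond scale \<alpha> m n f' g"
  using diamond_add_left[of m n f "- f'" g] diamond_minus_left[of m n f' g] by simp

lemma diamond_diff_right:
  "f \<in> C m \<Longrightarrow> diamond scale \<alpha> m n f (g - g') = diamond scale \<alpha> m n f g - diamond scale \<alpha> m n f g'"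
  using diamond_add_right[of f m n g "- g'"] diamond_minus_right[of f m n g'] by simp

text \<open>Signs are resolved by parity, so that identities between brackets reduce to finitely many identities in
  an abelian group.\<close>

lemma bracket_parity:
  "bracket m n f g = (if even (m * n) then diamond scale \<alpha> m n f g - diamond scale \<alpha> n m g f
     else diamond scale \<alpha> m n f g + diamond scale \<alpha> n m g f)"
  unfolding Gerstenhaber_bracket_def cochain_sign_scale by simp

text \<open>Expanding the brackets gives the twelve products of \<open>x, y, z\<close> in either bracketing. Each of the
  three instances of the pre-Lie identity eliminates one left-nested product; the other terms cancel
  for every choice of parities.\<close>

lemma bracket_Jacobi:
  assumes x: "x \<in> C i" and y: "y \<in> C j" and z: "z \<in> C k"
  shows "bracket i (j + k) x (bracket j k y z) =
        bracket (i + j) k (bracket i j x y) z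
        + cochain_scale scale ((-1) ^ (i * j)) (bracket j (i + k) y (bracket i k x z))"
proof -
  have xyz: "diamond scale \<alpha> (i + j) k (diamond scale \<alpha> i j x y) z
      = diamond scale \<alpha> i (j + k) x (diamond scale \<alpha> j k y z)
        + cochain_scale scale ((-1) ^ (j * k)) (diamond scale \<alpha> (i + k) j (diamond scale \<alpha> i k x z) y
          - diamond scale \<alpha> i (j + k) x (diamond scale \<alpha> k j z y))"
    using diamond_pre_Lie[OF x y z] by (metis add.commute diff_add_cancel)
  have yxz: "diamond scale \<alpha> (i + j) k (diamond scale \<alpha> j i y x) z
      = diamond scale \<alpha> j (i + k) y (diamond scale \<alpha> i k x z)
        + cochain_scale scale ((-1) ^ (i * k)) (diamond scale \<alpha> (j + k) i (diamond scale \<alpha> j k y z) x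
          - diamond scale \<alpha> j (i + k) y (diamond scale \<alpha> k i z x))"
    using diamond_pre_Lie[OF y x z] by (metis add.commute diff_add_cancel)
  have zxy: "diamond scale \<alpha> (i + k) j (diamond scale \<alpha> k i z x) y
      = diamond scale \<alpha> k (i + j) z (diamond scale \<alpha> i j x y)
        + cochain_scale scale ((-1) ^ (i * j)) (diamond scale \<alpha> (j + k) i (diamond scale \<alpha> k j z y) x
          - diamond scale \<alpha> k (i + j) z (diamond scale \<alpha> j i y x))"
    using diamond_pre_Lie[OF z x y] by (metis add.commute diff_add_cancel)
  note expand = diamond_diff_left diamond_add_left diamond_minus_left diamond_add_right[OF x]
    diamond_diff_right[OF x] diamond_diff_right[OF y] diamond_diff_right[OF z] diamond_add_right[OF y]
    diamond_add_right[OF z] diamond_minus_right[OF x] diamond_minus_right[OF y] diamond_minus_right[OF z]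
  show ?thesis
    unfolding bracket_parity
    by (cases "even i"; cases "even j"; cases "even k")
      (simp_all add: expand add.commute[of j i] add.commute[of k i] add.commute[of k j]
        xyz yxz zxy)
qed

lemma graded_Lie_algebra_cochains:
  "graded_Lie_algebra (cochain_scale scale) (\<lambda>n. cochains scale \<alpha> (n + 1)) bracket"
proof (unfold_locales, unfold Suc_eq_plus1[symmetric])
  show "cochain.subspace (C i)" for i by (rule subspace_C)
next
  fix x y i j
  assume x: "x \<in> C i" and y: "y \<in> C j"
  have "diamond scale \<alpha> i j x y \<in> C (i + j)" "diamond scale \<alpha> j i y x \<in> C (i + j)"
    using diamond_closed[OF x y] diamond_closed[OF y x] by (simp_all add: add.commute)
  then show "bracket i j x y \<in> C (i + j)"
    unfolding Gerstenhaber_bracket_def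
    by (intro cochain.subspace_diff cochain.subspace_scale subspace_C)
  show "bracket i j x y = - cochain_scale scale ((-1) ^ (i * j)) (bracket j i y x)"
    unfolding bracket_parity cochain_sign_scale by (simp add: mult.commute)
  show "bracket i j (cochain_scale scale c x) y = cochain_scale scale c (bracket i j x y)"
    "bracket i j x (cochain_scale scale c y) = cochain_scale scale c (bracket i j x y)" for c
    unfolding Gerstenhaber_bracket_def diamond_scale_left diamond_scale_right[OF x] diamond_scale_right[OF y]
    by (simp_all add: cochain.scale_right_diff_distrib mult.commute)
next
  fix x x' y i j
  assume "x \<in> C i" "x' \<in> C i" and y: "y \<in> C j"
  show "bracket i j (x + x') y = bracket i j x y + bracket i j x' y"
    unfolding Gerstenhaber_bracket_def diamond_add_left diamond_add_right[OF y]
    by (simp add: cochain.scale_right_distrib)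
next
  fix x y y' i j
  assume x: "x \<in> C i" and "y \<in> C j" "y' \<in> C j"
  show "bracket i j x (y + y') = bracket i j x y + bracket i j x y'"
    unfolding Gerstenhaber_bracket_def diamond_add_left diamond_add_right[OF x]
    by (simp add: cochain.scale_right_distrib)
next
  fix x y z i j k
  assume "x \<in> C i" "y \<in> C j" "z \<in> C k"
  then show "bracket i (j + k) x (bracket j k y z) =
        bracket (i + j) k (bracket i j x y) z
        + cochain_scale scale ((-1) ^ (i * j)) (bracket j (i + k) y (bracket i k x z))"
    by (rule bracket_Jacobi)
qed

end

text \<open>The derivation rule holds because brackets with 0 vanish, by homogeneity at the scalar 0.\<close>

lemma (in graded_Lie_algebra) bidifferential_zero:
  "bidifferential_graded_Lie_algebra scale L bracket (\<lambda>_ _. 0) (\<lambda>_ _. 0)"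
proof -
  have zero: "0 \<in> L i" for i
    by (rule subspace_0[OF subspace_L])
  have "bracket i j 0 y = 0" if "y \<in> L j" for i j y
    using bracket_scale_left[OF zero that, of i 0] by simp
  moreover have "bracket i j x 0 = 0" if "x \<in> L i" for i j x
    using bracket_scale_right[OF that zero, of j 0] by simp
  ultimately show ?thesis
    by unfold_locales (simp_all add: zero)
qed


section \<open>Maurer-Cartan elements\<close>

lemma length_2_cases:
  assumes "length xs = 2"
  obtains a b where "xs = [a, b]"
  using assms by (auto simp: numeral_2_eq_2 length_Suc_conv)

text \<open>Maurer-Cartan elements are certain pairs of degree-1 cochains, compatible structures are certain pairs
  of multiplicative bilinear maps, and the ambient sets of pairs are in bijection; this reduces the
  correspondence to an equivalence of the defining equations.\<close>

lemma bij_betw_restrict: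
  assumes "bij_betw F X Y" and "M \<subseteq> X" and "A \<subseteq> Y" and "\<And>x. x \<in> X \<Longrightarrow> F x \<in> A \<longleftrightarrow> x \<in> M"
  shows "bij_betw F M A"
proof (rule bij_betw_subset[OF assms(1,2)])
  show "F ` M = A"
    using assms(2-4) bij_betw_imp_surj_on[OF assms(1)] by blast
qed

context hom_vector_space
begin

definition multiplication :: "('a list \<Rightarrow> 'a) \<Rightarrow> 'a \<Rightarrow> 'a \<Rightarrow> 'a"
  where "multiplication \<theta> a b = \<theta> [a, b]"

definition cochain_of :: "('a \<Rightarrow> 'a \<Rightarrow> 'a) \<Rightarrow> 'a list \<Rightarrow> 'a"
  where "cochain_of \<mu> xs = (if length xs = 2 then \<mu> (xs ! 0) (xs ! 1) else 0)"

definition multiplicative_maps :: "('a \<Rightarrow> 'a \<Rightarrow> 'a) set"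
  where "multiplicative_maps = {\<mu>. bilinear_map scale \<mu> \<and> (\<forall>a b. \<alpha> (\<mu> a b) = \<mu> (\<alpha> a) (\<alpha> b))}"

lemma multiplication_multiplicative:
  assumes "\<theta> \<in> C 1"
  shows "multiplication \<theta> \<in> multiplicative_maps"
proof -
  have "Vector_Spaces.linear scale scale (\<lambda>b. \<theta> [a, b])" for a
    using cochain_linear[OF assms, of "[a]" "[]"] by simp
  moreover have "Vector_Spaces.linear scale scale (\<lambda>a. \<theta> [a, b])" for b
    using cochain_linear[OF assms, of "[]" "[b]"] by simp
  moreover have "\<alpha> (\<theta> [a, b]) = \<theta> [\<alpha> a, \<alpha> b]" for a b
    using assms unfolding cochains_def by simp
  ultimately show ?thesis
    by (simp add: multiplicative_maps_def bilinear_map_def multiplication_def[abs_def])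
qed

lemma cochain_of_closed:
  assumes "\<mu> \<in> multiplicative_maps"
  shows "cochain_of \<mu> \<in> C 1"
proof (rule cochainsI)
  fix A B :: "'a list"
  assume "length A + length B + 1 = Suc 1"
  then consider a where "A = [a]" "B = []" | b where "A = []" "B = [b]"
    by (cases A; cases B) auto
  then show "Vector_Spaces.linear scale scale (\<lambda>x. cochain_of \<mu> (A @ x # B))"
    using assms by cases (simp_all add: cochain_of_def multiplicative_maps_def bilinear_map_def)
qed (use assms in \<open>auto simp: cochain_of_def multiplicative_maps_def\<close>)

text \<open>Cochains vanish on lists of the wrong length, so a cochain of degree 1 is determined by its values on
  two arguments.\<close>

lemma bij_betw_multiplication: "bij_betw multiplication (C 1) multiplicative_maps"
proof (rule bij_betw_byWitness[where f' = cochain_of])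
  show "\<forall>\<theta>\<in>C 1. cochain_of (multiplication \<theta>) = \<theta>"
    by (auto simp: fun_eq_iff cochain_of_def multiplication_def cochains_def elim!: length_2_cases)
  show "\<forall>\<mu>\<in>multiplicative_maps. multiplication (cochain_of \<mu>) = \<mu>"
    by (simp add: fun_eq_iff cochain_of_def multiplication_def)
qed (use multiplication_multiplicative cochain_of_closed in auto)

lemma diamond_degree_1:
  "diamond scale \<alpha> 1 1 \<theta> \<theta>' [a, b, c]
    = \<theta> [\<theta>' [a, b], \<alpha> c] - \<theta> [\<alpha> a, \<theta>' [b, c]]"
  by (simp add: diamond_def numeral_2_eq_2)

text \<open>In degree 1 the sign in the bracket is \<open>-(-1) = 1\<close>, so the bracket is the symmetric sum
  \<open>\<theta> \<diamond> \<theta>' + \<theta>' \<diamond> \<theta>\<close>, a cochain in three arguments.\<close>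

lemma bracket_degree_1_eq_0_iff:
  "bracket 1 1 \<theta> \<theta>' = 0 \<longleftrightarrow>
    (\<forall>a b c. \<theta>' [\<theta> [a, b], \<alpha> c] + \<theta> [\<theta>' [a, b], \<alpha> c]
      = \<theta> [\<alpha> a, \<theta>' [b, c]] + \<theta>' [\<alpha> a, \<theta> [b, c]])"
proof -
  have bracket: "bracket 1 1 \<theta> \<theta>' = diamond scale \<alpha> 1 1 \<theta> \<theta>' + diamond scale \<alpha> 1 1 \<theta>' \<theta>"
    by (simp add: bracket_parity)
  have other: "bracket 1 1 \<theta> \<theta>' xs = 0" if "length xs \<noteq> 3" for xs
    using that unfolding bracket by (simp add: diamond_def)
  have "bracket 1 1 \<theta> \<theta>' = 0 \<longleftrightarrow> (\<forall>a b c. bracket 1 1 \<theta> \<theta>' [a, b, c] = 0)"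
  proof
    assume *: "\<forall>a b c. bracket 1 1 \<theta> \<theta>' [a, b, c] = 0"
    show "bracket 1 1 \<theta> \<theta>' = 0"
    proof
      fix xs
      show "bracket 1 1 \<theta> \<theta>' xs = 0 xs"
      proof (cases "length xs = 3")
        case True
        then obtain a b c where "xs = [a, b, c]"
          by (auto simp: numeral_3_eq_3 length_Suc_conv)
        with * show ?thesis by simp
      next
        case False
        then show ?thesis using other by (simp only: zero_fun_apply)
      qed
    qed
  qed simp
  also have "\<dots> \<longleftrightarrow> (\<forall>a b c. \<theta>' [\<theta> [a, b], \<alpha> c] + \<theta> [\<theta>' [a, b], \<alpha> c]
      = \<theta> [\<alpha> a, \<theta>' [b, c]] + \<theta>' [\<alpha> a, \<theta> [b, c]])"
    unfolding bracket plus_fun_apply diamond_degree_1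
    by (simp add: algebra_simps)
  finally show ?thesis .
qed

text \<open>For \<open>\<theta> = \<theta>'\<close> both sides of \<open>bracket_degree_1_eq_0_iff\<close> are doubled; characteristic 0 allows to halve
  them.\<close>

lemma self_bracket_eq_0_iff:
  "cochain_scale scale (1 / 2) (bracket 1 1 \<theta> \<theta>) = 0 \<longleftrightarrow>
    (\<forall>a b c. \<theta> [\<theta> [a, b], \<alpha> c] = \<theta> [\<alpha> a, \<theta> [b, c]])"
proof -
  have "scale 2 x = x + x" for x
    using scale_left_distrib[of 1 1 x] by simp
  then have "x + x = y + y \<longleftrightarrow> x = y" for x y :: 'a
    using scale_left_imp_eq[of 2 x y] by auto
  then show ?thesis
    unfolding cochain.scale_eq_0_iff bracket_degree_1_eq_0_iff by simp
qed

lemma Maurer_Cartan_iff_compatible: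
  assumes "\<theta>1 \<in> C 1" and "\<theta>2 \<in> C 1"
  shows "(\<theta>1, \<theta>2) \<in> Maurer_Cartan (cochain_scale scale) (\<lambda>n. cochains scale \<alpha> (n + 1)) bracket
      (\<lambda>_ _. 0) (\<lambda>_ _. 0)
    \<longleftrightarrow> compatible_Hom_associative_algebra scale (multiplication \<theta>1) (multiplication \<theta>2) \<alpha>"
proof -
  have "Hom_associative_algebra scale (multiplication \<theta>) \<alpha> \<longleftrightarrow>
      cochain_scale scale (1 / 2) (bracket 1 1 \<theta> \<theta>) = 0" if "\<theta> \<in> C 1" for \<theta>
    using multiplication_multiplicative[OF that] linear_alpha
    unfolding self_bracket_eq_0_iff
    by (simp add: Hom_associative_algebra_def multiplicative_maps_def multiplication_def)
  then show ?thesis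
    using assms bracket_degree_1_eq_0_iff[of \<theta>1 \<theta>2]
    by (simp add: Maurer_Cartan_def compatible_Hom_associative_algebra_def multiplication_def)
qed

lemma bij_betw_Maurer_Cartan:
  "bij_betw (map_prod multiplication multiplication)
    (Maurer_Cartan (cochain_scale scale) (\<lambda>n. cochains scale \<alpha> (n + 1)) bracket (\<lambda>_ _. 0) (\<lambda>_ _. 0))
    {(\<mu>1, \<mu>2). compatible_Hom_associative_algebra scale \<mu>1 \<mu>2 \<alpha>}"
  (is "bij_betw ?F ?MC ?A")
proof -
  have bij: "bij_betw ?F (C 1 \<times> C 1) (multiplicative_maps \<times> multiplicative_maps)"
    by (rule bij_betw_map_prod[OF bij_betw_multiplication bij_betw_multiplication])
  have MC: "?MC \<subseteq> C 1 \<times> C 1"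
    by (auto simp: Maurer_Cartan_def)
  have A: "?A \<subseteq> multiplicative_maps \<times> multiplicative_maps"
    by (auto simp: compatible_Hom_associative_algebra_def Hom_associative_algebra_def multiplicative_maps_def)
  have iff: "?F \<theta> \<in> ?A \<longleftrightarrow> \<theta> \<in> ?MC" if "\<theta> \<in> C 1 \<times> C 1" for \<theta>
    using that Maurer_Cartan_iff_compatible[of "fst \<theta>" "snd \<theta>"]
    by (cases \<theta>) (simp only: map_prod_simp mem_Collect_eq prod.case fst_conv snd_conv mem_Sigma_iff)
  show ?thesis
    by (rule bij_betw_restrict[OF bij MC A iff])
qed

end

theorem proposition2p6:
  fixes scale :: "'k::field_char_0 \<Rightarrow> 'a::ab_group_add \<Rightarrow> 'a"
    and Basis :: "'a set"
    and \<alpha> :: "'a \<Rightarrow> 'a"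
  assumes "finite_dimensional_vector_space scale Basis"
    and "Vector_Spaces.linear scale scale \<alpha>"
  shows "bidifferential_graded_Lie_algebra (cochain_scale scale)
             (\<lambda>n. cochains scale \<alpha> (n + 1))
             (Gerstenhaber_bracket scale \<alpha>) (\<lambda>_ _. 0) (\<lambda>_ _. 0) \<and>
         bij_betw (\<lambda>(\<theta>1, \<theta>2). (\<lambda>a b. \<theta>1 [a, b], \<lambda>a b. \<theta>2 [a, b]))
           (Maurer_Cartan (cochain_scale scale)
             (\<lambda>n. cochains scale \<alpha> (n + 1))
             (Gerstenhaber_bracket scale \<alpha>) (\<lambda>_ _. 0) (\<lambda>_ _. 0))
           {(\<mu>1, \<mu>2). compatible_Hom_associative_algebra scale \<mu>1 \<mu>2 \<alpha>}"
proof -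
  interpret V: finite_dimensional_vector_space scale Basis by fact
  interpret hom_vector_space scale \<alpha>
    by (intro hom_vector_space.intro hom_vector_space_axioms.intro V.vector_space_axioms assms(2))
  have "(\<lambda>(\<theta>1, \<theta>2). (\<lambda>a b. \<theta>1 [a, b], \<lambda>a b. \<theta>2 [a, b])) = map_prod multiplication multiplication"
    by (auto simp: fun_eq_iff multiplication_def)
  with graded_Lie_algebra.bidifferential_zero[OF graded_Lie_algebra_cochains] bij_betw_Maurer_Cartan
  show ?thesis by simp
qed

end
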